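(* The number $\displaystyle\sum_{n=1}^{\infty}\frac{1}{p_n!}$ is irrational, where $p_n$ denotes the $n$-th prime. *)

theory Defs
  imports Complex_Main "HOL-Library.Infinite_Set" "HOL-Computational_Algebra.Primes"
begin

text \<open>The sequence of primes is indexed from 1; \<open>enumerate\<close> counts from 0, hence the shift.
  The value at index 0 is junk.\<close>

definition nth_prime :: "nat \<Rightarrow> nat" where
  "nth_prime n = enumerate {p. prime p} (n - 1)"

lemma nth_prime_1: "nth_prime 1 = 2"
  unfolding nth_prime_def
  by (auto simp: enumerate_0 intro!: Least_equality prime_ge_2_nat)

lemma nth_prime_Suc_Suc:
  "nth_prime (Suc (Suc n)) = (LEAST p. prime p \<and> nth_prime (Suc n) < p)"
  unfolding nth_prime_def by (simp add: enumerate_Suc'' primes_infinite)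

text \<open>The series converges, so its \<open>suminf\<close> is its actual sum.\<close>

lemma summable_inverse_fact_nth_prime:
  "summable (\<lambda>n. 1 / fact (nth_prime (Suc n)) :: real)"
proof (rule summable_comparison_test')
  show "summable (\<lambda>n. inverse (fact n) :: real)"
    using summable_exp[of "1::real"] by simp
  fix n :: nat
  have "n \<le> nth_prime (Suc n)"
    unfolding nth_prime_def by (simp add: le_enumerate primes_infinite)
  then have "(fact n :: real) \<le> fact (nth_prime (Suc n))"
    by (rule fact_mono)
  then show "norm (1 / fact (nth_prime (Suc n)) :: real) \<le> inverse (fact n)"
    by (simp add: field_simps)
qed

end

theory Submission
  imports Defs
begin

text \<open>As in Fourier's proof for \<open>e\<close>: if the sum were rational with denominator \<open>b\<close>, multiplying
  it by \<open>N!\<close> for a term \<open>1/N!\<close> with \<open>N > b\<close> would leave an integer, and so would the terms up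
  to \<open>1/N!\<close>; but \<open>N!\<close> times the remaining tail lies strictly between 0 and 1.\<close>

text \<open>Each of the \<open>n\<close> factors by which \<open>(m + n)!\<close> exceeds
  \<open>m!\<close> is at least \<open>m + 1\<close>. This turns the factorial tail into a geometric
  one.\<close>

lemma fact_mult_power_le_fact_add:
  "fact m * Suc m ^ n \<le> (fact (m + n) :: nat)"
proof (induction n)
  case (Suc n)
  have "fact m * Suc m ^ Suc n = Suc m * (fact m * Suc m ^ n)"
    by (simp add: algebra_simps)
  also have "\<dots> \<le> Suc (m + n) * fact (m + n)"
    using Suc by (intro mult_mono) auto
  finally show ?case by simp
qed simp

lemma suminf_inverse_fact_strict_mono_irrational:
  fixes f :: "nat \<Rightarrow> nat"
  assumes f: "strict_mono f" and summable: "summable (\<lambda>n. 1 / fact (f n) :: real)"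
  shows "(\<Sum>n. 1 / fact (f n) :: real) \<notin> \<rat>"
proof
  assume "(\<Sum>n. 1 / fact (f n) :: real) \<in> \<rat>"
  then obtain a :: int and b :: nat
    where b: "b > 0" and S: "(\<Sum>n. 1 / fact (f n) :: real) = of_int a / real b"
    by (auto elim: Rats_cases' simp: Rats_eq_int_div_nat)
  \<comment> \<open>The index \<open>Suc b\<close> forces \<open>N > b\<close> because a strictly
    increasing \<open>f\<close> satisfies \<open>n \<le> f n\<close>. The tail \<open>T\<close> then
    starts at the next index, \<open>Suc (Suc b)\<close>.\<close>
  define N where "N = f (Suc b)"
  define T where "T = (\<lambda>n. fact N / fact (f (n + Suc (Suc b))) :: real)"
  have N: "Suc b \<le> N"
    unfolding N_def using f by (rule strict_mono_imp_increasing)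
  \<comment> \<open>Each step raises \<open>f\<close> by at least 1, so the denominator is at least
    \<open>(N + Suc n)!\<close>. The base 3 comes from \<open>Suc N \<ge> b + 2\<close> and
    \<open>b \<ge> 1\<close>.\<close>
  have T_le: "T n \<le> (1 / 3) ^ Suc n" for n
  proof -
    have "N + Suc n \<le> f (n + Suc (Suc b))"
    proof (induction n)
      case 0
      then show ?case unfolding N_def using strict_monoD[OF f, of "Suc b" "Suc (Suc b)"] by simp
    next
      case (Suc n)
      then show ?case
        using strict_monoD[OF f, of "n + Suc (Suc b)" "Suc n + Suc (Suc b)"] by simp
    qed
    then have "(fact (N + Suc n) :: nat) \<le> fact (f (n + Suc (Suc b)))"
      by (rule fact_mono)
    moreover have "fact N * 3 ^ Suc n \<le> fact N * Suc N ^ Suc n"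
      using N b by (intro mult_left_mono power_mono) auto
    ultimately have "(fact N * 3 ^ Suc n :: nat) \<le> fact (f (n + Suc (Suc b)))"
      using fact_mult_power_le_fact_add[of N "Suc n"] by linarith
    then have "real (fact N * 3 ^ Suc n) \<le> real (fact (f (n + Suc (Suc b))))"
      by (rule of_nat_mono)
    then show ?thesis
      unfolding T_def by (simp add: field_simps)
  qed
  have "summable (\<lambda>n. fact N * (1 / fact (f (n + Suc (Suc b)))) :: real)"
    by (intro summable_mult summable_ignore_initial_segment summable)
  then have summable_T: "summable T"
    by (simp add: T_def)
  \<comment> \<open>The comparison of sums is not strict; ratio 1/3 gives the bound 1/2, whereas
    ratio 1/2 would only give 1.\<close>
  have "suminf T \<le> (\<Sum>n. (1 / 3) ^ Suc n)"
    using T_le summable_T by (intro suminf_le summable_Suc_iff[THEN iffD2] summable_geometric) auto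
  also have "(\<Sum>n. (1 / 3 :: real) ^ Suc n) = 1 / 2"
    using suminf_mult[OF summable_geometric[of "1 / 3 :: real"], of "1 / 3"]
    by (simp add: suminf_geometric)
  finally have "suminf T < 1" by simp
  moreover have "suminf T > 0"
    using summable_T by (intro suminf_pos) (auto simp: T_def)
  \<comment> \<open>The scaled tail is the scaled full sum minus the scaled terms up to index
    \<open>Suc b\<close>; both are integers, since \<open>N!\<close> is divisible by
    \<open>b\<close> and by each \<open>(f n)!\<close> with \<open>n \<le> Suc b\<close>.\<close>
  moreover have "suminf T \<in> \<int>"
  proof -
    have "fact N * (\<Sum>n. 1 / fact (f n) :: real)
        = fact N * (\<Sum>n. 1 / fact (f (n + Suc (Suc b)))) + fact N * (\<Sum>n<Suc (Suc b). 1 / fact (f n))"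
      by (subst suminf_split_initial_segment[OF summable, of "Suc (Suc b)"])
        (simp only: distrib_left)
    moreover have "fact N * (\<Sum>n. 1 / fact (f (n + Suc (Suc b))) :: real) = suminf T"
      unfolding T_def
      using suminf_mult[OF summable_ignore_initial_segment[OF summable], of "fact N" "Suc (Suc b)"]
      by simp
    moreover have "fact N * (\<Sum>n<Suc (Suc b). 1 / fact (f n) :: real) \<in> \<int>"
      unfolding sum_distrib_left
    proof (intro Ints_sum)
      fix n assume "n \<in> {..<Suc (Suc b)}"
      then have "f n \<le> N"
        unfolding N_def using strict_mono_less_eq[OF f] by auto
      then have "(fact (f n) :: nat) dvd fact N"
        by (rule fact_dvd)
      then obtain c where "fact N = fact (f n) * (c :: nat)" ..
      then have "real (fact N) = real (fact (f n)) * real c"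
        by (metis of_nat_mult)
      then show "fact N * (1 / fact (f n) :: real) \<in> \<int>"
        by simp
    qed
    moreover have "fact N * (\<Sum>n. 1 / fact (f n) :: real) \<in> \<int>"
    proof -
      have "b dvd fact N"
        using b N by (intro dvd_fact) auto
      then obtain c where "fact N = b * c" ..
      then have "real (fact N) = real b * real c"
        by (metis of_nat_mult)
      then show ?thesis
        using b by (simp add: S)
    qed
    ultimately show ?thesis
      by (metis Ints_diff add_diff_cancel_right')
  qed
  ultimately show False
    by (auto elim!: Ints_cases)
qed

theorem theorem65:
  shows "(\<Sum>n. 1 / fact (nth_prime (Suc n)) :: real) \<notin> \<rat>"
proof (rule suminf_inverse_fact_strict_mono_irrational)
  \<comment> \<open>The shift matters: \<open>nth_prime 0\<close> and \<open>nth_prime 1\<close> are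
    both 2, so only the shifted sequence is strictly increasing.\<close>
  show "strict_mono (\<lambda>n. nth_prime (Suc n))"
    by (auto simp: nth_prime_def primes_infinite intro!: strict_monoI enumerate_mono)
qed (rule summable_inverse_fact_nth_prime)

end
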